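(* Let $(x^{(k)})_{k\geqslant 0}$ be a sequence of iterates generated by an exact coordinate descent for the minimisation of $R$ over $\mathbb{R}^N$, with either the $\mathcal{H}$ rule or the BI rule. For every $\varepsilon\in(0,1)$, there exists an integer $k_\varepsilon\geqslant 0$ such that for all $k\geqslant k_\varepsilon$, $$R(x^{(k)})\leqslant\big(1-\iota_Q\,\mathfrak{a}_{\infty,\varepsilon}\big)^{k-k_\varepsilon}R(x^{(k_\varepsilon)}).$$
   Context: Let $N\geqslant 1$ be an integer, let $Q\in\mathbb{R}^{N\times N}$ be a symmetric positive-semidefinite matrix with $Q_{i,i}>0$ for all $i\in[N]=\{1,\dots,N\}$, and let $c\in\mathbb{R}^N$ be a non-zero vector in the column space of $Q$. Fix $\alpha\in\mathbb{R}^N$ with $Q\alpha=c$. Let $e_1,\dots,e_N$ be the canonical basis of $\mathbb{R}^N$. $Q^\dagger$ is the Moore–Penrose inverse of $Q$, and $\|c\|_{Q^\dagger}^2=c^TQ^\dagger c=c^T\alpha$. Two vectors are collinear if they are linearly dependent. Maps. $D(x)=x^TQx-2c^Tx+c^T\alpha$ for $x\in\mathbb{R}^N$. Set $\mathscr{C}=\{x\in\mathbb{R}^N : c^Tx>0\}$ (for $x\in\mathscr{C}$ one has $x^TQx>0$). The relaxed map is $R(x)=\min_{s\geqslant 0}D(sx)$, that is, $R(x)=c^T\alpha-(c^Tx)^2/(x^TQx)$ if $x\in\mathscr{C}$, and $R(x)=c^T\alpha$ otherwise. Set $s_x=(c^Tx)/(x^TQx)$ if $x\in\mathscr{C}$,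 and $s_x=0$ otherwise; then $R(x)=D(s_xx)$. For $x,v\in\mathbb{R}^N$, set $\Upsilon(x;v)=(c^Tv)(x^TQx)-(c^Tx)(v^TQx)$. Improvements. $\mathcal{I}_D(x;v)=D(x)-\min_{t\in\mathbb{R}}D(x+tv)$ and $\mathcal{I}_R(x;v)=R(x)-\min_{z\in\operatorname{span}\{x,v\}}R(z)$. Coordinate descent for $R$. The initial iterate $x^{(0)}\in\mathscr{C}$ satisfies the initialisation condition $R(x^{(0)})\leqslant\min_{i\in[N]}R(\operatorname{sign}(c_i)e_i)$. For $k\geqslant 0$, $x^{(k+1)}=x^{(k)}+\tau^{(k)}e_{i^{(k)}}$, where the index $i^{(k)}$ is - for the $\mathcal{H}$ rule, any element of $\arg\max_{i\in[N]}\mathcal{I}_D(s_{x^{(k)}}x^{(k)};e_i)$, where $\mathcal{I}_D(s_xx;e_i)=[s_xQx-c]_i^2/Q_{i,i}$; - for the BI (best improvement) rule, any element of $\arg\max_{i\in[N]}\mathcal{I}_R(x^{(k)};e_i)$; the same rule being used at every iteration, and $\tau^{(k)}$ is the exact line-search step: $\tau^{(k)}=\Upsilon(x^{(k)};e_{i^{(k)}})/\Upsilon(e_{i^{(k)}};x^{(k)})$ if $Qx^{(k)}$ and $Qe_{i^{(k)}}$ are non-collinear, and $\tau^{(k)}=0$ if they are collinear. Constants. $\iota_Q=\lambda_{\min}(Q)/(N\max_{i\in[N]}Q_{i,i})\in(0,1]$, with $\lambda_{\min}(Q)>0$ the smallest non-zero eigenvalue of $Q$. Further, $$\mathfrak{a}_\infty=\min_{i\in[N]}\Big(1-\frac{c_i^2}{Q_{i,i}\|c\|_{Q^\dagger}^2}\Big)^{-1}\geqslant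 1,\qquad \mathfrak{a}_{\infty,\varepsilon}=(1-\varepsilon)\,\mathfrak{a}_\infty,$$ with the convention $0^{-1}=+\infty$; in the degenerate case $\mathfrak{a}_\infty=+\infty$, the inequality of the claim is read as $R(x^{(k)})=0$. *)

theory Defs
  imports "HOL-Analysis.Analysis"
begin

section \<open>Linear algebra\<close>

definition pos_semidefinite :: "real^'n^'n \<Rightarrow> bool" where
  "pos_semidefinite A \<longleftrightarrow> transpose A = A \<and> (\<forall>x. 0 \<le> x \<bullet> (A *v x))"

definition real_eigenvalue :: "real^'n^'n \<Rightarrow> real \<Rightarrow> bool" where
  "real_eigenvalue A l \<longleftrightarrow> (\<exists>v. v \<noteq> 0 \<and> A *v v = l *\<^sub>R v)"

definition lambda_min :: "real^'n^'n \<Rightarrow> real" where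
  "lambda_min A = Min {l. real_eigenvalue A l \<and> l \<noteq> 0}"

text \<open>Linear dependence of the pair \<open>(u, v)\<close>, as a family: unlike \<open>dependent {u, v}\<close>, this holds
  for \<open>u = v\<close>.\<close>

definition collinear_vectors :: "'a::real_vector \<Rightarrow> 'a \<Rightarrow> bool" where
  "collinear_vectors u v \<longleftrightarrow> (\<exists>a b. (a \<noteq> 0 \<or> b \<noteq> 0) \<and> a *\<^sub>R u + b *\<^sub>R v = 0)"

definition is_moore_penrose :: "real^'n^'m \<Rightarrow> real^'m^'n \<Rightarrow> bool" where
  "is_moore_penrose A X \<longleftrightarrow>
     A ** X ** A = A \<and> X ** A ** X = X \<and>
     transpose (A ** X) = A ** X \<and> transpose (X ** A) = X ** A"

definition moore_penrose :: "real^'n^'m \<Rightarrow> real^'m^'n" where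
  "moore_penrose A = (THE X. is_moore_penrose A X)"

definition pinv_norm_sq :: "real^'n^'n \<Rightarrow> real^'n \<Rightarrow> real" where
  "pinv_norm_sq Q c = c \<bullet> (moore_penrose Q *v c)"


section \<open>The quadratic map and its relaxation\<close>

text \<open>The minima below are written as infima. They are attained when \<open>Q\<close> is positive-semidefinite
  and \<open>Q *v \<alpha> = c\<close>, since a quadratic map that is bounded below attains its infimum on every
  subspace, affine line and half-line; on a subspace, the relaxed map has the same infimum as the quadratic
  one.\<close>

definition D_map :: "real^'n^'n \<Rightarrow> real^'n \<Rightarrow> real^'n \<Rightarrow> real^'n \<Rightarrow> real" where
  "D_map Q c \<alpha> x = x \<bullet> (Q *v x) - 2 * (c \<bullet> x) + c \<bullet> \<alpha>"

definition pos_cone :: "real^'n \<Rightarrow> (real^'n) set" where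
  "pos_cone c = {x. c \<bullet> x > 0}"

definition R_map :: "real^'n^'n \<Rightarrow> real^'n \<Rightarrow> real^'n \<Rightarrow> real^'n \<Rightarrow> real" where
  "R_map Q c \<alpha> x = (INF s\<in>{0..}. D_map Q c \<alpha> (s *\<^sub>R x))"

definition opt_scale :: "real^'n^'n \<Rightarrow> real^'n \<Rightarrow> real^'n \<Rightarrow> real" where
  "opt_scale Q c x = (if x \<in> pos_cone c then (c \<bullet> x) / (x \<bullet> (Q *v x)) else 0)"

definition Upsilon :: "real^'n^'n \<Rightarrow> real^'n \<Rightarrow> real^'n \<Rightarrow> real^'n \<Rightarrow> real" where
  "Upsilon Q c x v = (c \<bullet> v) * (x \<bullet> (Q *v x)) - (c \<bullet> x) * (v \<bullet> (Q *v x))"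

definition improvement_D :: "real^'n^'n \<Rightarrow> real^'n \<Rightarrow> real^'n \<Rightarrow> real^'n \<Rightarrow> real^'n \<Rightarrow> real" where
  "improvement_D Q c \<alpha> x v = D_map Q c \<alpha> x - (INF t. D_map Q c \<alpha> (x + t *\<^sub>R v))"

definition improvement_R :: "real^'n^'n \<Rightarrow> real^'n \<Rightarrow> real^'n \<Rightarrow> real^'n \<Rightarrow> real^'n \<Rightarrow> real" where
  "improvement_R Q c \<alpha> x v = R_map Q c \<alpha> x - (INF z\<in>span {x, v}. R_map Q c \<alpha> z)"


section \<open>Exact coordinate descent for the relaxed map\<close>

text \<open>A selection rule maps an iterate to the set of indices it allows.\<close>

definition H_rule :: "real^'n^'n \<Rightarrow> real^'n \<Rightarrow> real^'n \<Rightarrow> real^'n \<Rightarrow> 'n set" where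
  "H_rule Q c \<alpha> x =
     {i. is_arg_max (\<lambda>j. improvement_D Q c \<alpha> (opt_scale Q c x *\<^sub>R x) (axis j 1)) (\<lambda>_. True) i}"

definition BI_rule :: "real^'n^'n \<Rightarrow> real^'n \<Rightarrow> real^'n \<Rightarrow> real^'n \<Rightarrow> 'n set" where
  "BI_rule Q c \<alpha> x = {i. is_arg_max (\<lambda>j. improvement_R Q c \<alpha> x (axis j 1)) (\<lambda>_. True) i}"

definition exact_step :: "real^'n^'n \<Rightarrow> real^'n \<Rightarrow> real^'n \<Rightarrow> 'n \<Rightarrow> real" where
  "exact_step Q c x i =
     (if collinear_vectors (Q *v x) (Q *v axis i 1) then 0
      else Upsilon Q c x (axis i 1) / Upsilon Q c (axis i 1) x)"

definition exact_coordinate_descent ::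
  "(real^'n \<Rightarrow> 'n set) \<Rightarrow> real^'n^'n \<Rightarrow> real^'n \<Rightarrow> real^'n \<Rightarrow> (nat \<Rightarrow> real^'n) \<Rightarrow> bool" where
  "exact_coordinate_descent rule Q c \<alpha> x \<longleftrightarrow>
     x 0 \<in> pos_cone c \<and>
     R_map Q c \<alpha> (x 0) \<le> (MIN i. R_map Q c \<alpha> (sgn (c $ i) *\<^sub>R axis i 1)) \<and>
     (\<forall>k. \<exists>i\<in>rule (x k). x (Suc k) = x k + exact_step Q c (x k) i *\<^sub>R axis i 1)"


section \<open>Constants\<close>

definition iota :: "real^'n^'n \<Rightarrow> real" where
  "iota Q = lambda_min Q / (real CARD('n) * (MAX i. Q $ i $ i))"

text \<open>The convention \<open>inverse 0 = \<infinity>\<close> is that of \<^typ>\<open>ereal\<close>.\<close>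

definition a_infty :: "real^'n^'n \<Rightarrow> real^'n \<Rightarrow> ereal" where
  "a_infty Q c = (MIN i. inverse (ereal (1 - (c $ i)\<^sup>2 / (Q $ i $ i * pinv_norm_sq Q c))))"

definition a_infty_eps :: "real^'n^'n \<Rightarrow> real^'n \<Rightarrow> real \<Rightarrow> ereal" where
  "a_infty_eps Q c \<epsilon> = ereal (1 - \<epsilon>) * a_infty Q c"


section \<open>Consistency of the definitions\<close>

lemma is_moore_penrose_unique:
  assumes "is_moore_penrose A X" "is_moore_penrose A Y"
  shows "X = Y"
proof -
  have X: "A ** X ** A = A" "X ** A ** X = X" "transpose (A ** X) = A ** X" "transpose (X ** A) = X ** A"
    and Y: "A ** Y ** A = A" "Y ** A ** Y = Y" "transpose (A ** Y) = A ** Y" "transpose (Y ** A) = Y ** A"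
    using assms unfolding is_moore_penrose_def by auto
  have "A ** X = (A ** Y) ** (A ** X)"
    using Y(1) by (metis matrix_mul_assoc)
  also have "\<dots> = transpose ((A ** X) ** (A ** Y))"
    using X(3) Y(3) by (simp add: matrix_transpose_mul)
  also have "\<dots> = A ** Y"
    using X(1) Y(3) by (metis matrix_mul_assoc)
  finally have 1: "A ** X = A ** Y" .
  have "X ** A = (X ** A) ** (Y ** A)"
    using Y(1) by (metis matrix_mul_assoc)
  also have "\<dots> = transpose ((Y ** A) ** (X ** A))"
    using X(4) Y(4) by (simp add: matrix_transpose_mul)
  also have "\<dots> = Y ** A"
    using X(1) Y(4) by (metis matrix_mul_assoc)
  finally have 2: "X ** A = Y ** A" .
  show ?thesis
    using X(2) Y(2) 1 2 by (metis matrix_mul_assoc)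
qed

lemma is_moore_penrose_exists:
  fixes A :: "real^'n^'m"
  shows "\<exists>X. is_moore_penrose A X"
proof -
  note [simp del] = transpose_matrix_vector
  let ?T = "transpose A"
  define P where "P = (\<lambda>y x. x \<in> range ((*v) ?T) \<and> ?T *v (A *v x - y) = 0)"
  have adj: "u \<bullet> (A *v v) = (?T *v u) \<bullet> v" for u v
    by (simp add: dot_lmul_matrix transpose_matrix_vector)
  have ker: "v = 0" if v: "v \<in> range ((*v) ?T)" "A *v v = 0" for v
  proof -
    obtain u where "v = ?T *v u" using v by auto
    hence "v \<bullet> v = u \<bullet> (A *v v)" by (simp add: adj)
    thus ?thesis using v by simp
  qed
  have nrm: "A *v v = 0" if "?T *v (A *v v) = 0" for v
  proof -
    have "(A *v v) \<bullet> (A *v v) = 0" using that by (simp only: adj inner_zero_left)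
    thus ?thesis by simp
  qed
  have subT: "subspace (range ((*v) ?T))"
    by (rule linear_subspace_image) auto
  have subA: "subspace (range ((*v) A))"
    by (rule linear_subspace_image) auto
  have uniq: "x = x'" if "P y x" "P y x'" for y x x'
  proof -
    have r: "x - x' \<in> range ((*v) ?T)"
      using that subT unfolding P_def by (blast intro: subspace_diff)
    have "?T *v (A *v (x - x')) = ?T *v (A *v x - y) - ?T *v (A *v x' - y)"
      by (simp add: matrix_vector_mult_diff_distrib)
    hence "A *v (x - x') = 0" using that nrm unfolding P_def by simp
    with ker r have "x - x' = 0" by blast
    thus ?thesis by simp
  qed
  have ex: "\<exists>x. P y x" for y
  proof -
    obtain a w where a: "a \<in> span (range ((*v) A))" and w: "\<And>z. z \<in> span (range ((*v) A)) \<Longrightarrow> orthogonal w z"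
      and y: "y = a + w"
      using orthogonal_subspace_decomp_exists[of "range ((*v) A)" y] by metis
    from a subA obtain u where u: "a = A *v u" by (auto simp: span_eq_iff[THEN iffD2])
    have "(A *v v) \<bullet> w = 0" for v
      using w[of "A *v v"] by (auto simp: span_base orthogonal_def inner_commute)
    hence "(?T *v w) \<bullet> (?T *v w) = 0" using adj by (metis inner_commute)
    hence Tw: "?T *v w = 0" by simp
    obtain u1 u2 where u1: "u1 \<in> span (range ((*v) ?T))"
      and u2: "\<And>z. z \<in> span (range ((*v) ?T)) \<Longrightarrow> orthogonal u2 z" and uu: "u = u1 + u2"
      using orthogonal_subspace_decomp_exists[of "range ((*v) ?T)" u] by metis
    have "(?T *v v) \<bullet> u2 = 0" for v
      using u2[of "?T *v v"] by (auto simp: span_base orthogonal_def inner_commute)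
    hence "(A *v u2) \<bullet> (A *v u2) = 0" using adj by metis
    hence Au2: "A *v u2 = 0" by simp
    have "u1 \<in> range ((*v) ?T)" using u1 subT by (auto simp: span_eq_iff[THEN iffD2])
    moreover have "A *v u1 - y = - w"
      using y u uu Au2 by (simp add: matrix_vector_right_distrib)
    ultimately have "P y u1" using Tw unfolding P_def
      using matrix_vector_mult_diff_distrib[of ?T 0 w] by simp
    thus ?thesis ..
  qed
  define g where "g = (\<lambda>y. THE x. P y x)"
  have g: "P y (g y)" for y
    unfolding g_def using ex uniq by (metis theI)
  have g_eq: "g y = x" if "P y x" for x y
    using g uniq that by blast
  have lin: "linear g"
  proof (rule linearI)
    fix y z :: "real^'m" and r :: real
    show "g (y + z) = g y + g z"
    proof (rule g_eq)
      have "g y + g z \<in> range ((*v) ?T)"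
        using g[of y] g[of z] subT unfolding P_def by (blast intro: subspace_add)
      moreover have "?T *v (A *v (g y + g z) - (y + z)) = ?T *v (A *v g y - y) + ?T *v (A *v g z - z)"
        by (simp add: matrix_vector_mult_diff_distrib matrix_vector_right_distrib)
      ultimately show "P (y + z) (g y + g z)" using g[of y] g[of z] unfolding P_def by simp
    qed
    show "g (r *\<^sub>R y) = r *\<^sub>R g y"
    proof (rule g_eq)
      have "r *\<^sub>R g y \<in> range ((*v) ?T)"
        using g[of y] subT unfolding P_def by (blast intro: subspace_scale)
      moreover have "?T *v (A *v (r *\<^sub>R g y) - r *\<^sub>R y) = r *\<^sub>R (?T *v (A *v g y - y))"
        by (simp add: matrix_vector_mult_diff_distrib matrix_vector_mult_scaleR scaleR_diff_right)
      ultimately show "P (r *\<^sub>R y) (r *\<^sub>R g y)" using g[of y] unfolding P_def by simp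
    qed
  qed
  define X where "X = matrix g"
  have Xg: "X *v y = g y" for y
    unfolding X_def using lin by (simp add: matrix_works)
  have PX: "X *v y \<in> range ((*v) ?T)" "?T *v (A *v (X *v y)) = ?T *v y" for y
    using g[of y] unfolding P_def Xg by (auto simp: matrix_vector_mult_diff_distrib)
  have TAX: "?T ** (A ** X) = ?T"
    by (rule matrix_eq[THEN iffD2]) (simp add: PX(2) matrix_vector_mul_assoc[symmetric])
  have AXA: "A ** X ** A = A"
  proof (rule matrix_eq[THEN iffD2], rule allI)
    fix v
    have "?T *v (A *v (X *v (A *v v) - v)) = 0"
      using PX(2)[of "A *v v"] by (simp add: matrix_vector_mult_diff_distrib)
    hence "A *v (X *v (A *v v) - v) = 0" by (rule nrm)
    thus "(A ** X ** A) *v v = A *v v"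
      by (simp add: matrix_vector_mult_diff_distrib matrix_vector_mul_assoc[symmetric])
  qed
  have sAX: "transpose (A ** X) = A ** X"
  proof -
    have "transpose (A ** X) = transpose X ** ?T" by (simp add: matrix_transpose_mul)
    also have "\<dots> = transpose X ** (?T ** (A ** X))" by (simp add: TAX)
    also have "\<dots> = transpose (A ** X) ** (A ** X)"
      by (simp add: matrix_transpose_mul matrix_mul_assoc)
    finally have e: "transpose (A ** X) = transpose (A ** X) ** (A ** X)" .
    have "transpose (transpose (A ** X)) = transpose (A ** X) ** (A ** X)"
      by (subst e) (simp add: matrix_transpose_mul)
    with e show ?thesis by simp
  qed
  have fixr: "X *v (A *v v) = v" if "v \<in> range ((*v) ?T)" for v
  proof -
    have "P (A *v v) v" using that unfolding P_def by simp
    thus ?thesis by (simp add: Xg g_eq)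
  qed
  have XAX: "X ** A ** X = X"
    by (rule matrix_eq[THEN iffD2]) (simp add: fixr PX(1) matrix_vector_mul_assoc[symmetric])
  have XAT: "X ** A ** ?T = ?T"
    by (rule matrix_eq[THEN iffD2]) (simp add: fixr matrix_vector_mul_assoc[symmetric])
  have sXA: "transpose (X ** A) = X ** A"
  proof -
    have "X ** A ** transpose (X ** A) = X ** A ** ?T ** transpose X"
      by (simp add: matrix_transpose_mul matrix_mul_assoc)
    also have "\<dots> = transpose (X ** A)" by (simp add: XAT matrix_transpose_mul)
    finally have e: "transpose (X ** A) = X ** A ** transpose (X ** A)" by simp
    have "transpose (transpose (X ** A)) = X ** A ** transpose (X ** A)"
      by (subst e) (simp add: matrix_transpose_mul matrix_mul_assoc)
    with e show ?thesis by simp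
  qed
  show ?thesis
    unfolding is_moore_penrose_def using AXA XAX sAX sXA by blast
qed

lemma moore_penrose: "is_moore_penrose A (moore_penrose A)"
  unfolding moore_penrose_def
  using is_moore_penrose_exists is_moore_penrose_unique by (metis theI)

lemma pinv_norm_sq_eq:
  assumes "transpose Q = Q" "Q *v \<alpha> = c"
  shows "pinv_norm_sq Q c = c \<bullet> \<alpha>"
proof -
  let ?X = "moore_penrose Q"
  have "c \<bullet> (?X *v c) = \<alpha> \<bullet> (Q *v (?X *v (Q *v \<alpha>)))"
    using assms by (metis dot_lmul_matrix transpose_matrix_vector)
  also have "Q *v (?X *v (Q *v \<alpha>)) = (Q ** ?X ** Q) *v \<alpha>"
    by (simp add: matrix_vector_mul_assoc matrix_mul_assoc)
  also have "\<dots> = c"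
    using moore_penrose[of Q] assms by (simp add: is_moore_penrose_def)
  finally show ?thesis by (simp add: pinv_norm_sq_def inner_commute)
qed

lemma D_map_scaleR:
  "D_map Q c \<alpha> (s *\<^sub>R x) = s\<^sup>2 * (x \<bullet> (Q *v x)) - 2 * s * (c \<bullet> x) + c \<bullet> \<alpha>"
  by (simp add: D_map_def matrix_vector_mult_scaleR power2_eq_square)

lemma quadratic_pos_on_cone:
  assumes "pos_semidefinite Q" "Q *v \<alpha> = c" "x \<in> pos_cone c"
  shows "x \<bullet> (Q *v x) > 0"
proof (rule ccontr)
  assume "\<not> x \<bullet> (Q *v x) > 0"
  hence z: "x \<bullet> (Q *v x) = 0" using assms(1) by (auto simp: pos_semidefinite_def not_less intro: antisym)
  have s: "\<alpha> \<bullet> (Q *v x) = c \<bullet> x"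
    using assms(1,2) unfolding pos_semidefinite_def by (metis dot_lmul_matrix transpose_matrix_vector)
  define b where "b = c \<bullet> x"
  define a where "a = \<alpha> \<bullet> c"
  have b: "b > 0" using assms(3) by (simp add: pos_cone_def b_def)
  have "0 \<le> (\<alpha> - t *\<^sub>R x) \<bullet> (Q *v (\<alpha> - t *\<^sub>R x))" for t
    using assms(1) by (auto simp: pos_semidefinite_def)
  moreover have "(\<alpha> - t *\<^sub>R x) \<bullet> (Q *v (\<alpha> - t *\<^sub>R x)) = a - 2 * t * b" for t
    using z s assms(2)
    by (simp add: matrix_vector_mult_diff_distrib matrix_vector_mult_scaleR inner_diff_left
        inner_diff_right a_def b_def inner_commute algebra_simps)
  ultimately have "0 \<le> a - 2 * ((a + 1) / (2 * b)) * b" by metis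
  with b show False by simp
qed

lemma R_map_eq_D_map:
  assumes "pos_semidefinite Q" "Q *v \<alpha> = c"
  shows "R_map Q c \<alpha> x = D_map Q c \<alpha> (opt_scale Q c x *\<^sub>R x)"
proof -
  define q b where "q = x \<bullet> (Q *v x)" and "b = c \<bullet> x"
  have le: "D_map Q c \<alpha> (opt_scale Q c x *\<^sub>R x) \<le> D_map Q c \<alpha> (s *\<^sub>R x)" if "s \<ge> 0" for s
  proof (cases "x \<in> pos_cone c")
    case True
    have "q > 0" using quadratic_pos_on_cone[OF assms True] by (simp add: q_def)
    have "s\<^sup>2 * q - 2 * s * b - ((b / q)\<^sup>2 * q - 2 * (b / q) * b) = q * (s - b / q)\<^sup>2"
      using \<open>q > 0\<close> by (simp add: power2_eq_square field_simps)
    moreover have "\<dots> \<ge> 0" using \<open>q > 0\<close> by simp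
    ultimately show ?thesis
      using True unfolding D_map_scaleR opt_scale_def q_def[symmetric] b_def[symmetric] by simp
  next
    case False
    hence "b \<le> 0" by (simp add: pos_cone_def b_def)
    moreover have "q \<ge> 0" using assms(1) by (simp add: pos_semidefinite_def q_def)
    ultimately have "s * b \<le> 0" "s\<^sup>2 * q \<ge> 0"
      using that by (auto intro: mult_nonneg_nonpos)
    thus ?thesis
      using False unfolding D_map_scaleR opt_scale_def q_def[symmetric] b_def[symmetric] by simp
  qed
  have "opt_scale Q c x \<ge> 0"
    using assms(1) by (auto simp: opt_scale_def pos_cone_def pos_semidefinite_def)
  with le show ?thesis
    unfolding R_map_def by (intro cInf_eq_minimum) auto
qed

lemma R_map_closed_form:
  assumes "pos_semidefinite Q" "Q *v \<alpha> = c"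
  shows "R_map Q c \<alpha> x =
    (if x \<in> pos_cone c then c \<bullet> \<alpha> - (c \<bullet> x)\<^sup>2 / (x \<bullet> (Q *v x)) else c \<bullet> \<alpha>)"
  using quadratic_pos_on_cone[OF assms, of x]
  by (auto simp: R_map_eq_D_map[OF assms] D_map_scaleR opt_scale_def power2_eq_square field_simps)

end

theory Submission
  imports Defs
begin

text \<open>
  Everything happens in the Euclidean geometry of the semi-inner product \<open>\<langle>u, v\<rangle> = u \<bullet> (Q *v v)\<close>. There
  \<open>c \<bullet> z = \<langle>\<alpha>, z\<rangle>\<close> and \<open>D z\<close> is the squared distance from \<open>z\<close> to \<open>\<alpha>\<close>, so that \<open>R x\<close> is the squared
  distance from \<open>\<alpha>\<close> to the half-line through \<open>x\<close>, with nearest point \<open>s\<^sub>x x\<close>.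

  An exact step from \<open>x\<close> along \<open>e\<close> should lower \<open>R x\<close> to the squared distance from \<open>\<alpha>\<close> to the plane
  spanned by \<open>x\<close> and \<open>e\<close>. Only the part of \<open>e\<close> orthogonal to \<open>x\<close> helps, hence the identity
  \<open>I\<^sub>R(x; e) sin\<^sup>2(x, e) = I\<^sub>D(s\<^sub>x x; e)\<close>, where \<open>sin\<close> is the sine of the angle between \<open>x\<close> and \<open>e\<close>. The
  projection of \<open>\<alpha>\<close> on the plane has to be a positive multiple of some \<open>x + \<tau> e\<close>; the initialisation
  condition, which the decrease of \<open>R\<close> preserves, ensures this (\<open>Upsilon_pos_of_R_map_le\<close>,
  \<open>exact_step_attains_improvement_R\<close>).

  The largest \<open>I\<^sub>D(s\<^sub>x x; e\<^sub>i)\<close> is at least \<open>\<iota>\<^sub>Q R x\<close>, because the gradient \<open>Q r\<close> at the residual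
  \<open>r = s\<^sub>x x - \<alpha>\<close> satisfies \<open>\<parallel>Q r\<parallel>\<^sup>2 \<ge> \<lambda>\<^sub>m\<^sub>i\<^sub>n \<langle>r, r\<rangle>\<close>. Therefore any \<open>\<kappa> \<ge> 0\<close> with \<open>\<kappa> sin\<^sup>2(x, e\<^sub>i) \<le> 1\<close> for all
  \<open>i\<close> gives one step with \<open>R x' \<le> (1 - \<iota>\<^sub>Q \<kappa>) R x\<close>. For the BI rule the bound is inherited from the
  \<open>H\<close> rule, because a BI index improves \<open>R\<close> at least as much (\<open>exact_step_contraction\<close>).

  The value \<open>\<kappa> = 1\<close> is always allowed and gives \<open>R (x k) \<longlonglongrightarrow> 0\<close>. Then \<open>x k\<close> aligns with \<open>\<alpha>\<close>, so
  \<open>sin\<^sup>2(x k, e\<^sub>i)\<close> tends to \<open>sin\<^sup>2(\<alpha>, e\<^sub>i)\<close>; since \<open>a\<^sub>\<infinity>\<close> is the smallest \<open>1 / sin\<^sup>2(\<alpha>, e\<^sub>i)\<close>, the value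
  \<open>\<kappa> = (1 - \<epsilon>) a\<^sub>\<infinity>\<close> is allowed from some iteration on, which is the claimed rate. If \<open>a\<^sub>\<infinity> = \<infinity>\<close>,
  every \<open>e\<^sub>i\<close> is aligned with \<open>\<alpha>\<close>, and the initialisation condition forces \<open>R = 0\<close> at once.
\<close>

section \<open>Geometry of the seminorm of a positive-semidefinite matrix\<close>

text \<open>The first-order condition at a minimum, used both for the kernel of \<open>Q\<close> and for the eigenvector
  that minimises the Rayleigh quotient. A small step against the sign of \<open>b\<close> would make the value
  negative.\<close>
lemma nonneg_quadratic_no_linear_term:
  fixes a b :: real
  assumes "\<And>t. 0 \<le> 2 * t * b + t\<^sup>2 * a"
  shows "b = 0"
proof (rule ccontr)
  assume "b \<noteq> 0"
  define d where "d = \<bar>a\<bar> + 1"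
  have d: "d > 0" "a \<le> d" by (auto simp: d_def)
  have "0 \<le> 2 * (- b / d) * b + (- b / d)\<^sup>2 * a" by (rule assms)
  also have "\<dots> \<le> 2 * (- b / d) * b + (- b / d)\<^sup>2 * d"
    using d by (intro add_left_mono mult_left_mono) auto
  also have "\<dots> = - (b\<^sup>2 / d)" using d by (simp add: field_simps power2_eq_square)
  also have "\<dots> < 0" using d \<open>b \<noteq> 0\<close> by simp
  finally show False by simp
qed

lemma pos_semidefinite_sym:
  assumes "pos_semidefinite Q"
  shows "u \<bullet> (Q *v v) = v \<bullet> (Q *v u)"
  using assms unfolding pos_semidefinite_def
  by (metis dot_lmul_matrix inner_commute transpose_matrix_vector)

lemma quadratic_add_scaleR:
  assumes "pos_semidefinite Q"
  shows "(u + t *\<^sub>R v) \<bullet> (Q *v (u + t *\<^sub>R v)) =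
    u \<bullet> (Q *v u) + 2 * t * (u \<bullet> (Q *v v)) + t\<^sup>2 * (v \<bullet> (Q *v v))"
  using pos_semidefinite_sym[OF assms, of v u]
  by (simp add: matrix_vector_right_distrib matrix_vector_mult_scaleR inner_add_left inner_add_right
      power2_eq_square algebra_simps)

lemma pos_semidefinite_null:
  assumes "pos_semidefinite Q" "v \<bullet> (Q *v v) = 0"
  shows "Q *v v = 0"
proof -
  have "0 \<le> 2 * t * (v \<bullet> (Q *v (Q *v v))) + t\<^sup>2 * ((Q *v v) \<bullet> (Q *v (Q *v v)))" for t
    using assms quadratic_add_scaleR[OF assms(1), of v t "Q *v v"]
    unfolding pos_semidefinite_def by (metis add_0)
  hence "v \<bullet> (Q *v (Q *v v)) = 0" by (rule nonneg_quadratic_no_linear_term)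
  thus ?thesis using pos_semidefinite_sym[OF assms(1), of v "Q *v v"] by simp
qed

text \<open>The vector is, up to the factor \<open>\<langle>v, v\<rangle>\<close>, the part of \<open>u\<close> that is \<open>Q\<close>-orthogonal to \<open>v\<close>; its squared
  seminorm is a multiple of the Gram determinant, whence the Cauchy--Schwarz inequality and its equality
  case.\<close>
lemma quadratic_gram_identity:
  assumes "pos_semidefinite Q"
  shows "((v \<bullet> (Q *v v)) *\<^sub>R u + (- (u \<bullet> (Q *v v))) *\<^sub>R v) \<bullet>
      (Q *v ((v \<bullet> (Q *v v)) *\<^sub>R u + (- (u \<bullet> (Q *v v))) *\<^sub>R v)) =
    (v \<bullet> (Q *v v)) * ((u \<bullet> (Q *v u)) * (v \<bullet> (Q *v v)) - (u \<bullet> (Q *v v))\<^sup>2)"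
  unfolding quadratic_add_scaleR[OF assms]
  by (simp add: matrix_vector_mult_scaleR power2_eq_square algebra_simps)

lemma pos_semidefinite_Cauchy_Schwarz:
  assumes "pos_semidefinite Q"
  shows "(u \<bullet> (Q *v v))\<^sup>2 \<le> (u \<bullet> (Q *v u)) * (v \<bullet> (Q *v v))"
proof (cases "v \<bullet> (Q *v v) = 0")
  case True
  thus ?thesis using pos_semidefinite_null[OF assms True] by simp
next
  case False
  hence "v \<bullet> (Q *v v) > 0" using assms unfolding pos_semidefinite_def by (metis less_eq_real_def)
  moreover have "0 \<le> (v \<bullet> (Q *v v)) * ((u \<bullet> (Q *v u)) * (v \<bullet> (Q *v v)) - (u \<bullet> (Q *v v))\<^sup>2)"
    using assms unfolding quadratic_gram_identity[OF assms, symmetric] pos_semidefinite_def by metis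
  ultimately show ?thesis by (simp add: zero_le_mult_iff)
qed

lemma pos_semidefinite_Cauchy_Schwarz_strict:
  assumes "pos_semidefinite Q" "\<not> collinear_vectors (Q *v u) (Q *v v)"
  shows "(u \<bullet> (Q *v v))\<^sup>2 < (u \<bullet> (Q *v u)) * (v \<bullet> (Q *v v))"
proof (rule ccontr)
  assume "\<not> ?thesis"
  hence "(u \<bullet> (Q *v u)) * (v \<bullet> (Q *v v)) - (u \<bullet> (Q *v v))\<^sup>2 = 0"
    using pos_semidefinite_Cauchy_Schwarz[OF assms(1), of u v] by simp
  hence "Q *v ((v \<bullet> (Q *v v)) *\<^sub>R u + (- (u \<bullet> (Q *v v))) *\<^sub>R v) = 0"
    using quadratic_gram_identity[OF assms(1), of v u]
    by (intro pos_semidefinite_null[OF assms(1)]) simp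
  hence eq: "(v \<bullet> (Q *v v)) *\<^sub>R (Q *v u) + (- (u \<bullet> (Q *v v))) *\<^sub>R (Q *v v) = 0"
    by (simp only: matrix_vector_right_distrib matrix_vector_mult_scaleR)
  have "v \<bullet> (Q *v v) \<noteq> 0"
  proof
    assume "v \<bullet> (Q *v v) = 0"
    hence "0 *\<^sub>R (Q *v u) + 1 *\<^sub>R (Q *v v) = 0" using pos_semidefinite_null[OF assms(1)] by simp
    thus False using assms(2) unfolding collinear_vectors_def by (metis zero_neq_one)
  qed
  with eq show False using assms(2) unfolding collinear_vectors_def by blast
qed

text \<open>The squared sine of the angle between \<open>u\<close> and \<open>v\<close> in the geometry of \<open>Q\<close>; it is \<open>1\<close> if one of them
  has seminorm \<open>0\<close>.\<close>
definition sin_sq :: "real^'n^'n \<Rightarrow> real^'n \<Rightarrow> real^'n \<Rightarrow> real" where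
  "sin_sq Q u v = 1 - (u \<bullet> (Q *v v))\<^sup>2 / ((u \<bullet> (Q *v u)) * (v \<bullet> (Q *v v)))"

lemma sin_sq_bounds:
  assumes "pos_semidefinite Q"
  shows "0 \<le> sin_sq Q u v" "sin_sq Q u v \<le> 1"
proof -
  have nonneg: "0 \<le> (u \<bullet> (Q *v u)) * (v \<bullet> (Q *v v))"
    using assms by (simp add: pos_semidefinite_def)
  show "0 \<le> sin_sq Q u v"
    using pos_semidefinite_Cauchy_Schwarz[OF assms, of u v] nonneg
    unfolding sin_sq_def diff_ge_0_iff_ge by (metis divide_le_eq_1 less_le zero_le_one div_by_0)
  show "sin_sq Q u v \<le> 1"
    using nonneg unfolding sin_sq_def by simp
qed

section \<open>The smallest nonzero eigenvalue\<close>

text \<open>Needed to know that the \<open>Min\<close> in \<open>lambda_min\<close> ranges over a finite set: eigenvectors for different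
  eigenvalues are orthogonal, and there are only finitely many pairwise orthogonal vectors.\<close>
lemma finite_real_eigenvalues:
  fixes Q :: "real^'n^'n"
  assumes "pos_semidefinite Q"
  shows "finite {l. real_eigenvalue Q l}"
proof -
  let ?E = "{l. real_eigenvalue Q l}"
  define w where "w = (\<lambda>l. SOME v. v \<noteq> 0 \<and> Q *v v = l *\<^sub>R v)"
  have w: "w l \<noteq> 0 \<and> Q *v w l = l *\<^sub>R w l" if "l \<in> ?E" for l
  proof -
    have "\<exists>v. v \<noteq> 0 \<and> Q *v v = l *\<^sub>R v" using that by (simp add: real_eigenvalue_def)
    thus ?thesis unfolding w_def by (rule someI_ex)
  qed
  have orth: "orthogonal (w l) (w m)" if "l \<in> ?E" "m \<in> ?E" "l \<noteq> m" for l m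
    using pos_semidefinite_sym[OF assms, of "w l" "w m"] w[OF that(1)] w[OF that(2)] that(3)
    by (simp add: orthogonal_def inner_commute)
  have inj: "inj_on w ?E"
    using orth w by (fastforce intro: inj_onI simp: orthogonal_def)
  have "pairwise orthogonal (w ` ?E)"
    using orth by (auto simp: pairwise_def)
  hence "finite (w ` ?E)" by (rule pairwise_orthogonal_imp_finite)
  thus ?thesis using inj by (rule finite_imageD)
qed

text \<open>A substitute for diagonalisation. The Rayleigh quotient attains a minimum \<open>\<mu>\<close> on the range of \<open>Q\<close> at
  some unit vector \<open>y\<close>. The residual \<open>Q y - \<mu> y\<close> lies in the range again, so the first-order condition
  in its direction makes it vanish, and \<open>\<mu>\<close> is a nonzero eigenvalue.\<close>
lemma lambda_min_le_Rayleigh_on_range: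
  fixes Q :: "real^'n^'n"
  assumes "pos_semidefinite Q" "Q \<noteq> 0"
  shows "lambda_min Q > 0"
    and "\<And>w. w \<in> range ((*v) Q) \<Longrightarrow> lambda_min Q * (w \<bullet> w) \<le> w \<bullet> (Q *v w)"
proof -
  let ?V = "range ((*v) Q)" and ?L = "{l. real_eigenvalue Q l \<and> l \<noteq> 0}"
  have sub: "subspace ?V" by (rule linear_subspace_image) auto
  obtain u where u: "Q *v u \<noteq> 0" using assms(2) by (metis matrix_eq matrix_vector_mult_0)
  have "compact (sphere 0 1 \<inter> ?V)"
    by (intro compact_Int_closed compact_sphere closed_subspace sub)
  moreover have "(1 / norm (Q *v u)) *\<^sub>R (Q *v u) \<in> sphere 0 1 \<inter> ?V"
    using u sub by (auto intro!: subspace_scale[OF sub])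
  moreover have "continuous_on (sphere 0 1 \<inter> ?V) (\<lambda>y. y \<bullet> (Q *v y))"
    by (intro continuous_intros linear_continuous_on matrix_vector_mul_bounded_linear)
  ultimately obtain y where "y \<in> sphere 0 1 \<inter> ?V"
    and "\<forall>z\<in>sphere 0 1 \<inter> ?V. y \<bullet> (Q *v y) \<le> z \<bullet> (Q *v z)"
    using continuous_attains_inf[of "sphere 0 1 \<inter> ?V" "\<lambda>y. y \<bullet> (Q *v y)"] by blast
  hence y: "norm y = 1" "y \<in> ?V"
    and min: "\<And>z. norm z = 1 \<Longrightarrow> z \<in> ?V \<Longrightarrow> y \<bullet> (Q *v y) \<le> z \<bullet> (Q *v z)"
    by auto
  define \<mu> where "\<mu> = y \<bullet> (Q *v y)"
  have yy: "y \<bullet> y = 1" using y(1) by (simp add: power2_norm_eq_inner[symmetric])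
  have Ray: "\<mu> * (w \<bullet> w) \<le> w \<bullet> (Q *v w)" if "w \<in> ?V" for w
  proof (cases "w = 0")
    case False
    define z where "z = (1 / norm w) *\<^sub>R w"
    have "norm z = 1" "z \<in> ?V" using False that sub by (auto simp: z_def intro!: subspace_scale[OF sub])
    hence "\<mu> * (norm w)\<^sup>2 \<le> (z \<bullet> (Q *v z)) * (norm w)\<^sup>2"
      using min by (auto simp: \<mu>_def intro: mult_right_mono)
    also have "\<dots> = w \<bullet> (Q *v w)"
      using False by (simp add: z_def matrix_vector_mult_scaleR power2_eq_square)
    finally show ?thesis by (simp add: power2_norm_eq_inner)
  qed simp
  define r where "r = Q *v y - \<mu> *\<^sub>R y"
  have rV: "r \<in> ?V" using y(2) by (auto simp: r_def intro!: subspace_diff[OF sub] subspace_scale[OF sub])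
  have "0 \<le> 2 * t * (r \<bullet> r) + t\<^sup>2 * (r \<bullet> (Q *v r) - \<mu> * (r \<bullet> r))" for t
  proof -
    have "y + t *\<^sub>R r \<in> ?V" by (intro subspace_add[OF sub] subspace_scale[OF sub] y(2) rV)
    from Ray[OF this]
    have "\<mu> * (1 + 2 * t * (r \<bullet> y) + t\<^sup>2 * (r \<bullet> r)) \<le>
        \<mu> + 2 * t * (r \<bullet> (Q *v y)) + t\<^sup>2 * (r \<bullet> (Q *v r))"
      unfolding quadratic_add_scaleR[OF assms(1)] using yy pos_semidefinite_sym[OF assms(1), of y r]
      by (simp add: \<mu>_def inner_add_left inner_add_right inner_commute power2_eq_square algebra_simps)
    moreover have "r \<bullet> (Q *v y) = r \<bullet> r + \<mu> * (r \<bullet> y)"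
      by (simp add: r_def inner_diff_right)
    ultimately show ?thesis by (simp add: algebra_simps)
  qed
  hence "r \<bullet> r = 0" by (rule nonneg_quadratic_no_linear_term)
  hence eig: "Q *v y = \<mu> *\<^sub>R y" by (simp add: r_def)
  have "\<mu> \<noteq> 0"
  proof
    assume "\<mu> = 0"
    obtain v where "y = Q *v v" using y(2) by auto
    hence "y \<bullet> y = v \<bullet> (Q *v y)" using pos_semidefinite_sym[OF assms(1), of y v] by simp
    thus False using eig \<open>\<mu> = 0\<close> yy by simp
  qed
  hence \<mu>L: "\<mu> \<in> ?L" using eig y(1) by (auto simp: real_eigenvalue_def intro!: exI[of _ y])
  have fin: "finite ?L" by (rule finite_subset[OF _ finite_real_eigenvalues[OF assms(1)]]) auto
  have "l > 0" if "l \<in> ?L" for l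
  proof -
    from that obtain v where v: "v \<noteq> 0" "Q *v v = l *\<^sub>R v" by (auto simp: real_eigenvalue_def)
    have "0 \<le> l * (v \<bullet> v)" using assms(1) v(2) unfolding pos_semidefinite_def by (metis inner_scaleR_right)
    moreover have "v \<bullet> v > 0" using v(1) by simp
    ultimately have "l \<ge> 0" by (simp add: zero_le_mult_iff)
    thus ?thesis using that by simp
  qed
  thus "lambda_min Q > 0" using fin \<mu>L unfolding lambda_min_def by (subst Min_gr_iff) auto
  fix w assume "w \<in> ?V"
  have "lambda_min Q \<le> \<mu>" unfolding lambda_min_def using fin \<mu>L by (rule Min_le)
  hence "lambda_min Q * (w \<bullet> w) \<le> \<mu> * (w \<bullet> w)" by (intro mult_right_mono) auto
  thus "lambda_min Q * (w \<bullet> w) \<le> w \<bullet> (Q *v w)" using Ray[OF \<open>w \<in> ?V\<close>] by linarith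
qed

text \<open>Both sides see only the component \<open>w\<close> of \<open>r\<close> in the range of \<open>Q\<close>. There the Rayleigh bound and the
  Euclidean Cauchy--Schwarz inequality give \<open>\<lambda>\<^sub>m\<^sub>i\<^sub>n \<parallel>w\<parallel> \<le> \<parallel>Q w\<parallel>\<close>, and a second use of Cauchy--Schwarz
  concludes.\<close>
lemma lambda_min_gradient_bound:
  fixes Q :: "real^'n^'n"
  assumes "pos_semidefinite Q" "Q \<noteq> 0"
  shows "lambda_min Q * (r \<bullet> (Q *v r)) \<le> (Q *v r) \<bullet> (Q *v r)"
proof -
  let ?V = "range ((*v) Q)" and ?l = "lambda_min Q"
  have sub: "subspace ?V" by (rule linear_subspace_image) auto
  obtain w n where "w \<in> span ?V" and n: "\<And>z. z \<in> span ?V \<Longrightarrow> orthogonal n z" and r: "r = w + n"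
    using orthogonal_subspace_decomp_exists[of ?V r] by metis
  hence w: "w \<in> ?V" using sub by (auto simp: span_eq_iff[THEN iffD2])
  have "n \<bullet> (Q *v (Q *v n)) = 0"
    using n[of "Q *v (Q *v n)"] by (simp add: orthogonal_def span_base)
  hence "(Q *v n) \<bullet> (Q *v n) = 0" using pos_semidefinite_sym[OF assms(1), of n "Q *v n"] by simp
  hence Qr: "Q *v r = Q *v w" by (simp add: r matrix_vector_right_distrib)
  have "n \<bullet> (Q *v w) = 0" using n[of "Q *v w"] by (simp add: orthogonal_def span_base)
  hence rQr: "r \<bullet> (Q *v r) = w \<bullet> (Q *v w)" unfolding Qr by (simp add: r inner_add_left)
  define A B where "A = norm w" and "B = norm (Q *v w)"
  have l: "?l > 0" by (rule lambda_min_le_Rayleigh_on_range[OF assms])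
  have CS: "w \<bullet> (Q *v w) \<le> A * B" by (simp add: A_def B_def norm_cauchy_schwarz)
  have "?l * A\<^sup>2 \<le> w \<bullet> (Q *v w)"
    using lambda_min_le_Rayleigh_on_range(2)[OF assms w] by (simp add: A_def power2_norm_eq_inner)
  hence "A * (?l * A) \<le> A * B" using CS by (simp add: power2_eq_square algebra_simps)
  hence "?l * A \<le> B"
    by (cases "A = 0") (auto simp: A_def B_def mult_le_cancel_left)
  hence "?l * A * B \<le> B * B" by (intro mult_right_mono) (auto simp: B_def)
  moreover have "?l * (w \<bullet> (Q *v w)) \<le> ?l * (A * B)" using CS l by simp
  ultimately show ?thesis
    unfolding rQr unfolding Qr by (simp add: B_def power2_norm_eq_inner[symmetric] power2_eq_square mult.assoc)
qed

lemma quadratic_axis: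
  "axis i 1 \<bullet> (Q *v axis i 1) = Q $ i $ i" for Q :: "real^'n^'n"
  by (simp add: inner_axis' matrix_vector_mul_component row_def inner_axis)

lemma iota_pos:
  fixes Q :: "real^'n^'n"
  assumes "pos_semidefinite Q" "\<And>i. Q $ i $ i > 0"
  shows "iota Q > 0"
proof -
  have "Q \<noteq> 0" using assms(2) by (metis less_irrefl zero_index)
  moreover have "(MAX i. Q $ i $ i) > 0" using assms(2) by (subst Max_gr_iff) auto
  ultimately show ?thesis
    using lambda_min_le_Rayleigh_on_range(1)[OF assms(1)] by (simp add: iota_def)
qed

text \<open>The squared norm of the gradient is at most \<open>N\<close> times its largest squared entry; this averaging and
  \<open>Q $ i $ i \<le> MAX i. Q $ i $ i\<close> account for the denominator of \<open>iota\<close>.\<close>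
lemma iota_le_largest_normalised_gradient_entry:
  fixes Q :: "real^'n^'n"
  assumes "pos_semidefinite Q" "\<And>i. Q $ i $ i > 0"
    and "\<And>j. ((Q *v r) $ j)\<^sup>2 / Q $ j $ j \<le> \<gamma>"
  shows "iota Q * (r \<bullet> (Q *v r)) \<le> \<gamma>"
proof -
  define M where "M = (MAX i. Q $ i $ i)"
  have M: "Q $ j $ j \<le> M" for j by (simp add: M_def)
  have Mpos: "M > 0" using assms(2) M by (meson less_le_trans)
  have \<gamma>: "\<gamma> \<ge> 0" using assms(2,3) by (meson divide_nonneg_pos order_trans zero_le_power2)
  have "Q \<noteq> 0" using assms(2) by (metis less_irrefl zero_index)
  hence "lambda_min Q * (r \<bullet> (Q *v r)) \<le> (Q *v r) \<bullet> (Q *v r)"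
    by (rule lambda_min_gradient_bound[OF assms(1)])
  also have "\<dots> = (\<Sum>j\<in>UNIV. ((Q *v r) $ j)\<^sup>2)"
    by (simp add: inner_vec_def power2_eq_square)
  also have "\<dots> \<le> (\<Sum>j\<in>(UNIV::'n set). \<gamma> * M)"
  proof (rule sum_mono)
    fix j
    have "((Q *v r) $ j)\<^sup>2 \<le> \<gamma> * Q $ j $ j" using assms(2,3)[of j] by (simp add: pos_divide_le_eq)
    also have "\<dots> \<le> \<gamma> * M" using M \<gamma> by (intro mult_left_mono)
    finally show "((Q *v r) $ j)\<^sup>2 \<le> \<gamma> * M" .
  qed
  finally show ?thesis
    using Mpos unfolding iota_def M_def[symmetric] by (simp add: pos_divide_le_eq mult_ac)
qed

section \<open>The quadratic map and its relaxation\<close>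

lemma inner_eq_Q_inner:
  assumes "pos_semidefinite Q" "Q *v \<alpha> = c"
  shows "c \<bullet> z = \<alpha> \<bullet> (Q *v z)"
  using pos_semidefinite_sym[OF assms(1), of z \<alpha>] assms(2) by (simp add: inner_commute)

lemma D_map_eq_residual:
  assumes "pos_semidefinite Q" "Q *v \<alpha> = c"
  shows "D_map Q c \<alpha> z = (z - \<alpha>) \<bullet> (Q *v (z - \<alpha>))"
  using quadratic_add_scaleR[OF assms(1), of z "-1" \<alpha>] assms(2)
  by (simp add: D_map_def inner_commute)

lemma R_map_nonneg:
  assumes "pos_semidefinite Q" "Q *v \<alpha> = c"
  shows "R_map Q c \<alpha> z \<ge> 0"
  using assms(1) unfolding R_map_eq_D_map[OF assms] D_map_eq_residual[OF assms]
  by (simp add: pos_semidefinite_def)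

lemma improvement_D_eq:
  assumes "pos_semidefinite Q" "v \<bullet> (Q *v v) > 0"
  shows "improvement_D Q c \<alpha> y v = (v \<bullet> (Q *v y - c))\<^sup>2 / (v \<bullet> (Q *v v))"
proof -
  define a g where "a = v \<bullet> (Q *v v)" and "g = v \<bullet> (Q *v y - c)"
  have D: "D_map Q c \<alpha> (y + t *\<^sub>R v) = D_map Q c \<alpha> y + 2 * t * g + t\<^sup>2 * a" for t
    using pos_semidefinite_sym[OF assms(1), of v y]
    unfolding D_map_def quadratic_add_scaleR[OF assms(1)] a_def g_def
    by (simp add: inner_add_right inner_diff_right inner_commute algebra_simps)
  have a: "a > 0" using assms(2) by (simp add: a_def)
  have sq: "D_map Q c \<alpha> (y + t *\<^sub>R v) = D_map Q c \<alpha> y - g\<^sup>2 / a + a * (t + g / a)\<^sup>2" for t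
    unfolding D using a by (simp add: power2_eq_square field_simps)
  have "(INF t. D_map Q c \<alpha> (y + t *\<^sub>R v)) = D_map Q c \<alpha> y - g\<^sup>2 / a"
  proof (rule cInf_eq_minimum)
    show "D_map Q c \<alpha> y - g\<^sup>2 / a \<in> range (\<lambda>t. D_map Q c \<alpha> (y + t *\<^sub>R v))"
      by (rule range_eqI[of _ _ "- g / a"]) (simp only: sq, use a in simp)
  qed (use a sq in auto)
  thus ?thesis by (simp add: improvement_D_def a_def g_def)
qed

lemma R_map_scaleR:
  assumes "pos_semidefinite Q" "Q *v \<alpha> = c" "a > 0"
  shows "R_map Q c \<alpha> (a *\<^sub>R z) = R_map Q c \<alpha> z"
  using assms(3) unfolding R_map_closed_form[OF assms(1,2)]
  by (simp add: pos_cone_def zero_less_mult_iff matrix_vector_mult_scaleR power2_eq_square)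

lemma pos_cone_iff_R_map_less:
  assumes "pos_semidefinite Q" "Q *v \<alpha> = c"
  shows "z \<in> pos_cone c \<longleftrightarrow> R_map Q c \<alpha> z < c \<bullet> \<alpha>"
  using quadratic_pos_on_cone[OF assms, of z] unfolding R_map_closed_form[OF assms]
  by (auto simp: pos_cone_def)

text \<open>The assumption says that \<open>\<alpha> - y\<close> is \<open>Q\<close>-orthogonal to \<open>z\<close>. If this holds for all \<open>z\<close> in a subspace that
  contains \<open>y\<close>, then \<open>y\<close> is the projection of \<open>\<alpha>\<close>, and the left-hand side is the squared distance to the
  subspace.\<close>
lemma R_map_ge_of_Q_orthogonal_residual:
  assumes "pos_semidefinite Q" "Q *v \<alpha> = c" "c \<bullet> z = y \<bullet> (Q *v z)"
  shows "c \<bullet> \<alpha> - y \<bullet> (Q *v y) \<le> R_map Q c \<alpha> z"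
proof -
  have yy: "0 \<le> y \<bullet> (Q *v y)" using assms(1) by (simp add: pos_semidefinite_def)
  have "(c \<bullet> z)\<^sup>2 / (z \<bullet> (Q *v z)) \<le> y \<bullet> (Q *v y)" if "z \<in> pos_cone c"
    using pos_semidefinite_Cauchy_Schwarz[OF assms(1), of y z] assms(3)
      quadratic_pos_on_cone[OF assms(1,2) that] by (simp add: pos_divide_le_eq)
  thus ?thesis using yy unfolding R_map_closed_form[OF assms(1,2)] by auto
qed

lemma span_pair_cases:
  assumes "z \<in> span {x, v}"
  obtains a b where "z = a *\<^sub>R x + b *\<^sub>R v"
proof -
  obtain a where "z - a *\<^sub>R x \<in> span {v}" using assms by (auto simp: span_breakdown_eq)
  then obtain b where "z - a *\<^sub>R x = b *\<^sub>R v" by (auto simp: span_singleton)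
  hence "z = a *\<^sub>R x + b *\<^sub>R v" by (simp add: algebra_simps)
  thus thesis by (rule that)
qed

text \<open>Up to a positive factor, \<open>x'\<close> is the \<open>Q\<close>-projection of \<open>\<alpha>\<close> on the plane spanned by \<open>x\<close> and \<open>v\<close>: Cramer's
  rule for the normal equations gives the coefficients \<open>Upsilon v x\<close> of \<open>x\<close> and \<open>Upsilon x v\<close> of \<open>v\<close>, over
  the Gram determinant. The first one being positive, \<open>x'\<close> is a positive multiple of the
  projection, and \<open>R\<close> takes the same value at both.\<close>
lemma improvement_R_noncollinear:
  assumes psd: "pos_semidefinite Q" and eq: "Q *v \<alpha> = c" and x: "x \<in> pos_cone c"
    and nc: "\<not> collinear_vectors (Q *v x) (Q *v v)" and pos: "Upsilon Q c v x > 0"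
  defines "x' \<equiv> x + (Upsilon Q c x v / Upsilon Q c v x) *\<^sub>R v"
  shows "R_map Q c \<alpha> x' = R_map Q c \<alpha> x - improvement_R Q c \<alpha> x v"
    and "improvement_R Q c \<alpha> x v * sin_sq Q x v =
      improvement_D Q c \<alpha> (opt_scale Q c x *\<^sub>R x) v"
proof -
  define q p m where "q = x \<bullet> (Q *v x)" and "p = v \<bullet> (Q *v v)" and "m = x \<bullet> (Q *v v)"
  define b e where "b = c \<bullet> x" and "e = c \<bullet> v"
  define det where "det = q * p - m\<^sup>2"
  have q: "q > 0" using quadratic_pos_on_cone[OF psd eq x] by (simp add: q_def)
  have b: "b > 0" using x by (simp add: pos_cone_def b_def)
  have det: "det > 0"
    using pos_semidefinite_Cauchy_Schwarz_strict[OF psd nc] by (simp add: det_def q_def p_def m_def)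
  have "q * p > 0" using det zero_le_power2[of m] unfolding det_def by linarith
  hence p: "p > 0" using q by (simp add: zero_less_mult_iff)
  have m': "v \<bullet> (Q *v x) = m" using pos_semidefinite_sym[OF psd, of v x] by (simp add: m_def)
  define A B where "A = b * p - e * m" and "B = e * q - b * m"
  have UA: "Upsilon Q c v x = A" and UB: "Upsilon Q c x v = B"
    by (simp_all add: Upsilon_def A_def B_def b_def e_def q_def p_def m_def m')
  have A: "A > 0" using pos UA by simp
  \<comment> \<open>The projection of \<open>\<alpha>\<close> is \<open>y / det\<close>; keeping \<open>y\<close> avoids the division.\<close>
  define y where "y = A *\<^sub>R x + B *\<^sub>R v"
  have yx': "y = A *\<^sub>R x'" using A by (simp add: y_def x'_def UA UB scaleR_add_right)
  \<comment> \<open>The normal equations of the projection.\<close>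
  have norm1: "A * q + B * m = det * b" and norm2: "A * m + B * p = det * e"
    by (simp_all add: A_def B_def det_def power2_eq_square algebra_simps)
  define P where "P = A * b + B * e"
  \<comment> \<open>\<open>P / det\<close> is the squared length of the projection, here split into its parts along \<open>x\<close> and
    orthogonal to \<open>x\<close>.\<close>
  have Pq: "P * q = det * b\<^sup>2 + B\<^sup>2"
    by (simp add: P_def A_def B_def det_def power2_eq_square algebra_simps)
  have "P * q > 0" unfolding Pq using det b by (simp add: add_pos_nonneg)
  hence P: "P > 0" using q by (simp add: zero_less_mult_iff)
  have cy: "c \<bullet> y = P" by (simp add: y_def P_def inner_add_right b_def e_def)
  have yz: "y \<bullet> (Q *v z) = det * (c \<bullet> z)" if z: "z = s *\<^sub>R x + t *\<^sub>R v" for s t z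
  proof -
    have "y \<bullet> (Q *v z) = s * (A * q + B * m) + t * (A * m + B * p)"
      unfolding y_def z
      by (simp add: matrix_vector_right_distrib matrix_vector_mult_scaleR inner_add_left inner_add_right
          q_def p_def m_def[symmetric] m' algebra_simps)
    also have "\<dots> = det * (c \<bullet> z)" unfolding norm1 norm2 z
      by (simp add: inner_add_right b_def e_def algebra_simps)
    finally show ?thesis .
  qed
  have yy: "y \<bullet> (Q *v y) = det * P" using yz[OF y_def] cy by simp
  have Ry: "R_map Q c \<alpha> y = c \<bullet> \<alpha> - P / det"
    using P det by (simp add: R_map_closed_form[OF psd eq] pos_cone_def cy yy power2_eq_square)
  have "(INF z\<in>span {x, v}. R_map Q c \<alpha> z) = c \<bullet> \<alpha> - P / det"
  proof (rule cInf_eq_minimum)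
    have "y \<in> span {x, v}" unfolding y_def by (intro span_add span_scale span_base) auto
    from imageI[OF this, of "R_map Q c \<alpha>"]
    show "c \<bullet> \<alpha> - P / det \<in> R_map Q c \<alpha> ` span {x, v}" unfolding Ry .
  next
    fix w assume "w \<in> R_map Q c \<alpha> ` span {x, v}"
    then obtain z where w: "w = R_map Q c \<alpha> z" and "z \<in> span {x, v}" by auto
    from this(2) obtain s t where z: "z = s *\<^sub>R x + t *\<^sub>R v" by (rule span_pair_cases)
    have "c \<bullet> z = ((1 / det) *\<^sub>R y) \<bullet> (Q *v z)" using yz[OF z] det by simp
    from R_map_ge_of_Q_orthogonal_residual[OF psd eq this]
    show "c \<bullet> \<alpha> - P / det \<le> w"
      using det w yy by (simp add: matrix_vector_mult_scaleR)
  qed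
  hence I: "improvement_R Q c \<alpha> x v = R_map Q c \<alpha> x - (c \<bullet> \<alpha> - P / det)"
    by (simp add: improvement_R_def)
  show "R_map Q c \<alpha> x' = R_map Q c \<alpha> x - improvement_R Q c \<alpha> x v"
    using R_map_scaleR[OF psd eq A, of x'] Ry unfolding I yx' by simp
  have Rx: "R_map Q c \<alpha> x = c \<bullet> \<alpha> - b\<^sup>2 / q"
    using x by (simp add: R_map_closed_form[OF psd eq] b_def q_def)
  have "P = (det * b\<^sup>2 + B\<^sup>2) / q" using Pq q by (simp add: field_simps)
  hence I': "improvement_R Q c \<alpha> x v = B\<^sup>2 / (q * det)"
    unfolding I Rx using q det by (simp add: field_simps)
  have S: "sin_sq Q x v = det / (q * p)"
    using q p unfolding sin_sq_def q_def[symmetric] p_def[symmetric] m_def[symmetric] det_def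
    by (simp add: field_simps)
  have g: "v \<bullet> (Q *v (opt_scale Q c x *\<^sub>R x) - c) = - B / q"
    using x q by (simp add: opt_scale_def q_def[symmetric] b_def[symmetric] matrix_vector_mult_scaleR
        inner_diff_right m' B_def e_def inner_commute[of v c] field_simps)
  have "improvement_D Q c \<alpha> (opt_scale Q c x *\<^sub>R x) v = (B / q)\<^sup>2 / p"
    using improvement_D_eq[OF psd, of v c \<alpha> "opt_scale Q c x *\<^sub>R x"] p
    unfolding g p_def[symmetric] by simp
  thus "improvement_R Q c \<alpha> x v * sin_sq Q x v =
      improvement_D Q c \<alpha> (opt_scale Q c x *\<^sub>R x) v"
    unfolding I' S using q det by (simp add: power2_eq_square)
qed

text \<open>In the geometry of \<open>Q\<close> the span of \<open>x\<close> and \<open>v\<close> is then the line through \<open>x\<close>, on which \<open>s\<^sub>x x\<close> is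
  already the point nearest to \<open>\<alpha>\<close>. This is why the null step is exact in this case.\<close>
lemma improvement_collinear:
  assumes psd: "pos_semidefinite Q" and eq: "Q *v \<alpha> = c" and x: "x \<in> pos_cone c"
    and v: "v \<bullet> (Q *v v) > 0" and col: "collinear_vectors (Q *v x) (Q *v v)"
  shows "improvement_R Q c \<alpha> x v = 0"
    and "improvement_D Q c \<alpha> (opt_scale Q c x *\<^sub>R x) v = 0"
proof -
  have xx: "x \<bullet> (Q *v x) > 0" by (rule quadratic_pos_on_cone[OF psd eq x])
  obtain a b where ab: "a \<noteq> 0 \<or> b \<noteq> 0" "a *\<^sub>R (Q *v x) + b *\<^sub>R (Q *v v) = 0"
    using col by (auto simp: collinear_vectors_def)
  have "b \<noteq> 0" using ab xx by auto
  define l where "l = - a / b"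
  have "b *\<^sub>R (Q *v v) = - (a *\<^sub>R (Q *v x))"
    using ab(2) by (metis add.commute add_eq_0_iff)
  hence "(1 / b) *\<^sub>R b *\<^sub>R (Q *v v) = (1 / b) *\<^sub>R (- (a *\<^sub>R (Q *v x)))" by (rule arg_cong)
  hence Qv: "Q *v v = l *\<^sub>R (Q *v x)" using \<open>b \<noteq> 0\<close> by (simp add: l_def)
  define s where "s = opt_scale Q c x"
  have s: "s * (x \<bullet> (Q *v x)) = c \<bullet> x" using x xx by (simp add: s_def opt_scale_def)
  have cz: "c \<bullet> z = (s *\<^sub>R x) \<bullet> (Q *v z)" if z: "z = t *\<^sub>R x + u *\<^sub>R v" for t u z
  proof -
    have Qz: "Q *v z = (t + u * l) *\<^sub>R (Q *v x)"
      by (simp add: z matrix_vector_right_distrib matrix_vector_mult_scaleR Qv scaleR_add_left)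
    have "c \<bullet> z = (t + u * l) * (c \<bullet> x)"
      unfolding inner_eq_Q_inner[OF psd eq] Qz by simp
    thus ?thesis unfolding Qz using s by (simp add: algebra_simps)
  qed
  have Rx: "R_map Q c \<alpha> x = c \<bullet> \<alpha> - (s *\<^sub>R x) \<bullet> (Q *v (s *\<^sub>R x))"
    using x xx by (simp add: R_map_closed_form[OF psd eq] s_def opt_scale_def matrix_vector_mult_scaleR
        power2_eq_square)
  have "(INF z\<in>span {x, v}. R_map Q c \<alpha> z) = R_map Q c \<alpha> x"
  proof (rule cInf_eq_minimum)
    show "R_map Q c \<alpha> x \<in> R_map Q c \<alpha> ` span {x, v}" by (intro imageI span_base) simp
  next
    fix w assume "w \<in> R_map Q c \<alpha> ` span {x, v}"
    then obtain z where w: "w = R_map Q c \<alpha> z" and "z \<in> span {x, v}" by auto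
    from this(2) obtain t u where z: "z = t *\<^sub>R x + u *\<^sub>R v" by (rule span_pair_cases)
    show "R_map Q c \<alpha> x \<le> w"
      using R_map_ge_of_Q_orthogonal_residual[OF psd eq cz[OF z]] by (simp only: Rx w)
  qed
  thus "improvement_R Q c \<alpha> x v = 0" by (simp add: improvement_R_def)
  have "c \<bullet> v = (s *\<^sub>R x) \<bullet> (Q *v v)" using cz[of v 0 1] by simp
  hence "v \<bullet> (Q *v (s *\<^sub>R x) - c) = 0"
    using pos_semidefinite_sym[OF psd, of v "s *\<^sub>R x"]
    by (simp add: inner_diff_right inner_commute)
  thus "improvement_D Q c \<alpha> (opt_scale Q c x *\<^sub>R x) v = 0"
    using improvement_D_eq[OF psd v, of c \<alpha> "s *\<^sub>R x"] by (simp add: s_def)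
qed

section \<open>One step of exact coordinate descent\<close>

lemma R_map_signed_direction:
  assumes "pos_semidefinite Q" "Q *v \<alpha> = c" "v \<bullet> (Q *v v) > 0"
  shows "R_map Q c \<alpha> (sgn (c \<bullet> v) *\<^sub>R v) = c \<bullet> \<alpha> - (c \<bullet> v)\<^sup>2 / (v \<bullet> (Q *v v))"
proof (cases "c \<bullet> v = 0")
  case True
  thus ?thesis by (simp add: R_map_closed_form[OF assms(1,2)] pos_cone_def)
next
  case False
  hence "sgn (c \<bullet> v) * (c \<bullet> v) > 0" by (metis abs_sgn mult.commute zero_less_abs_iff)
  moreover have "sgn (c \<bullet> v) * sgn (c \<bullet> v) = 1" using False by (simp add: sgn_if)
  ultimately show ?thesis
    by (simp add: R_map_closed_form[OF assms(1,2)] pos_cone_def matrix_vector_mult_scaleR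
        power2_eq_square mult.assoc[symmetric])
qed

text \<open>The bound on \<open>R x\<close> says that the angle from \<open>\<alpha>\<close> to \<open>x\<close> is at most the angle from \<open>\<alpha>\<close> to the line
  through \<open>v\<close>. Then \<open>x\<close> enters with a positive coefficient when \<open>\<alpha>\<close> is projected on the plane of \<open>x\<close> and
  \<open>v\<close>.\<close>
lemma Upsilon_pos_of_R_map_le:
  assumes psd: "pos_semidefinite Q" and eq: "Q *v \<alpha> = c" and x: "x \<in> pos_cone c"
    and v: "v \<bullet> (Q *v v) > 0" and init: "R_map Q c \<alpha> x \<le> R_map Q c \<alpha> (sgn (c \<bullet> v) *\<^sub>R v)"
    and nc: "\<not> collinear_vectors (Q *v x) (Q *v v)"
  shows "Upsilon Q c v x > 0"
proof -
  define q p m where "q = x \<bullet> (Q *v x)" and "p = v \<bullet> (Q *v v)" and "m = x \<bullet> (Q *v v)"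
  define b e where "b = c \<bullet> x" and "e = c \<bullet> v"
  have q: "q > 0" using quadratic_pos_on_cone[OF psd eq x] by (simp add: q_def)
  have b: "b > 0" using x by (simp add: pos_cone_def b_def)
  have p: "p > 0" using v by (simp add: p_def)
  have m: "m\<^sup>2 < q * p"
    using pos_semidefinite_Cauchy_Schwarz_strict[OF psd nc] by (simp add: q_def p_def m_def)
  have "e\<^sup>2 / p \<le> b\<^sup>2 / q"
    using init x unfolding R_map_signed_direction[OF psd eq v] R_map_closed_form[OF psd eq, of x]
    by (simp add: q_def p_def e_def b_def)
  hence eb: "e\<^sup>2 * q \<le> b\<^sup>2 * p" using p q by (simp add: field_simps)
  have "e * m < b * p"
  proof (cases "e = 0")
    case False
    have "(e * m)\<^sup>2 = e\<^sup>2 * m\<^sup>2" by (simp add: power_mult_distrib)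
    also have "\<dots> < e\<^sup>2 * (q * p)" using m False by (intro mult_strict_left_mono) auto
    also have "\<dots> \<le> (b\<^sup>2 * p) * p" using mult_right_mono[OF eb, of p] p by (simp add: mult.assoc)
    also have "\<dots> = (b * p)\<^sup>2" by (simp add: power2_eq_square)
    finally show ?thesis using b p by (meson power_less_imp_less_base less_imp_le mult_pos_pos)
  qed (use b p in simp)
  thus ?thesis
    using pos_semidefinite_sym[OF psd, of v x]
    by (simp add: Upsilon_def q_def p_def m_def b_def e_def)
qed

lemma improvement_R_nonneg:
  assumes "pos_semidefinite Q" "Q *v \<alpha> = c"
  shows "improvement_R Q c \<alpha> x v \<ge> 0"
proof -
  have "(INF z\<in>span {x, v}. R_map Q c \<alpha> z) \<le> R_map Q c \<alpha> x"
    using R_map_nonneg[OF assms] by (intro cINF_lower bdd_belowI2[of _ 0] span_base) auto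
  thus ?thesis by (simp add: improvement_R_def)
qed

text \<open>In the collinear case the second identity reads \<open>0 = 0\<close>, so both identities hold without
  distinguishing the two cases of the step size.\<close>
lemma exact_step_attains_improvement_R:
  assumes psd: "pos_semidefinite Q" and eq: "Q *v \<alpha> = c" and x: "x \<in> pos_cone c"
    and diag: "Q $ i $ i > 0"
    and init: "R_map Q c \<alpha> x \<le> R_map Q c \<alpha> (sgn (c $ i) *\<^sub>R axis i 1)"
  shows "R_map Q c \<alpha> (x + exact_step Q c x i *\<^sub>R axis i 1) =
      R_map Q c \<alpha> x - improvement_R Q c \<alpha> x (axis i 1)"
    and "improvement_R Q c \<alpha> x (axis i 1) * sin_sq Q x (axis i 1) =
      improvement_D Q c \<alpha> (opt_scale Q c x *\<^sub>R x) (axis i 1)"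
proof -
  let ?e = "axis i 1"
  have v: "?e \<bullet> (Q *v ?e) > 0" using diag by (simp add: quadratic_axis)
  have init': "R_map Q c \<alpha> x \<le> R_map Q c \<alpha> (sgn (c \<bullet> ?e) *\<^sub>R ?e)"
    using init by (simp add: inner_axis)
  show "R_map Q c \<alpha> (x + exact_step Q c x i *\<^sub>R ?e) = R_map Q c \<alpha> x - improvement_R Q c \<alpha> x ?e"
    using improvement_R_noncollinear(1)[OF psd eq x _ Upsilon_pos_of_R_map_le[OF psd eq x v init']]
      improvement_collinear(1)[OF psd eq x v]
    by (simp add: exact_step_def)
  show "improvement_R Q c \<alpha> x ?e * sin_sq Q x ?e =
      improvement_D Q c \<alpha> (opt_scale Q c x *\<^sub>R x) ?e"
    using improvement_R_noncollinear(2)[OF psd eq x _ Upsilon_pos_of_R_map_le[OF psd eq x v init']]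
      improvement_collinear[OF psd eq x v]
    by (cases "collinear_vectors (Q *v x) (Q *v ?e)") auto
qed

lemma H_rule_improvement_D:
  fixes Q :: "real^'n^'n"
  assumes psd: "pos_semidefinite Q" and diag: "\<And>i. Q $ i $ i > 0" and eq: "Q *v \<alpha> = c"
    and i: "i \<in> H_rule Q c \<alpha> x"
  shows "iota Q * R_map Q c \<alpha> x \<le> improvement_D Q c \<alpha> (opt_scale Q c x *\<^sub>R x) (axis i 1)"
proof -
  define y where "y = opt_scale Q c x *\<^sub>R x"
  have I: "improvement_D Q c \<alpha> y (axis j 1) = ((Q *v (y - \<alpha>)) $ j)\<^sup>2 / Q $ j $ j" for j
    using improvement_D_eq[OF psd, of "axis j 1" c \<alpha> y] diag[of j] eq
    unfolding quadratic_axis by (simp add: inner_axis' matrix_vector_mult_diff_distrib)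
  have "improvement_D Q c \<alpha> y (axis j 1) \<le> improvement_D Q c \<alpha> y (axis i 1)" for j
    using i by (simp add: H_rule_def is_arg_max_def y_def not_less)
  hence "iota Q * ((y - \<alpha>) \<bullet> (Q *v (y - \<alpha>))) \<le> improvement_D Q c \<alpha> y (axis i 1)"
    by (intro iota_le_largest_normalised_gradient_entry psd diag) (simp only: I)
  thus ?thesis
    by (simp add: R_map_eq_D_map[OF psd eq] D_map_eq_residual[OF psd eq] y_def)
qed

lemma H_rule_nonempty:
  fixes Q :: "real^'n^'n"
  shows "\<exists>i. i \<in> H_rule Q c \<alpha> x"
proof -
  define f where "f = (\<lambda>j. improvement_D Q c \<alpha> (opt_scale Q c x *\<^sub>R x) (axis j 1))"
  have "Max (range f) \<in> range f" by (intro Max_in) auto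
  then obtain i where "f i = Max (range f)" by fastforce
  hence "f j \<le> f i" for j by (metis Max_ge finite finite_imageI rangeI)
  thus ?thesis by (auto simp: H_rule_def is_arg_max_def f_def not_less intro!: exI[of _ i])
qed

text \<open>For an \<open>H\<close> index \<open>j\<close>, \<open>\<iota>\<^sub>Q \<kappa> R x \<le> \<kappa> I\<^sub>D = \<kappa> sin\<^sup>2(x, e\<^sub>j) I\<^sub>R \<le> I\<^sub>R\<close>. A BI index has at least this
  improvement. The parameter \<open>\<kappa>\<close> is left free because it is used with the values \<open>0\<close> (monotonicity),
  \<open>1\<close> (convergence) and \<open>(1 - \<epsilon>) a\<^sub>\<infinity>\<close> (asymptotic rate).\<close>
lemma exact_step_contraction:
  fixes Q :: "real^'n^'n"
  assumes psd: "pos_semidefinite Q" and diag: "\<And>i. Q $ i $ i > 0" and eq: "Q *v \<alpha> = c"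
    and x: "x \<in> pos_cone c"
    and init: "\<And>j. R_map Q c \<alpha> x \<le> R_map Q c \<alpha> (sgn (c $ j) *\<^sub>R axis j 1)"
    and i: "i \<in> H_rule Q c \<alpha> x \<or> i \<in> BI_rule Q c \<alpha> x"
    and \<kappa>: "\<kappa> \<ge> 0" "\<And>j. \<kappa> * sin_sq Q x (axis j 1) \<le> 1"
  shows "R_map Q c \<alpha> (x + exact_step Q c x i *\<^sub>R axis i 1) \<le> (1 - iota Q * \<kappa>) * R_map Q c \<alpha> x"
proof -
  let ?I = "\<lambda>j. improvement_R Q c \<alpha> x (axis j 1)"
  let ?J = "\<lambda>j. improvement_D Q c \<alpha> (opt_scale Q c x *\<^sub>R x) (axis j 1)"
  have H: "iota Q * \<kappa> * R_map Q c \<alpha> x \<le> ?I j" if j: "j \<in> H_rule Q c \<alpha> x" for j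
  proof -
    have "iota Q * \<kappa> * R_map Q c \<alpha> x \<le> \<kappa> * ?J j"
      using mult_left_mono[OF H_rule_improvement_D[OF psd diag eq j] \<kappa>(1)] by (simp add: mult_ac)
    also have "\<dots> = (\<kappa> * sin_sq Q x (axis j 1)) * ?I j"
      using exact_step_attains_improvement_R(2)[OF psd eq x diag init, of j] by (simp add: mult_ac)
    also have "\<dots> \<le> 1 * ?I j"
      using \<kappa>(2) improvement_R_nonneg[OF psd eq] by (rule mult_right_mono)
    finally show ?thesis by simp
  qed
  have "iota Q * \<kappa> * R_map Q c \<alpha> x \<le> ?I i"
    using i
  proof
    assume BI: "i \<in> BI_rule Q c \<alpha> x"
    obtain j where "j \<in> H_rule Q c \<alpha> x" using H_rule_nonempty by metis
    from H[OF this] show ?thesis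
      using BI by (auto simp: BI_rule_def is_arg_max_def not_less intro: order_trans)
  qed (rule H)
  thus ?thesis
    unfolding exact_step_attains_improvement_R(1)[OF psd eq x diag init] by (simp add: algebra_simps)
qed

section \<open>Convergence of the iterates\<close>

lemma sin_sq_scaleR:
  assumes "s \<noteq> 0"
  shows "sin_sq Q (s *\<^sub>R u) v = sin_sq Q u v"
  using assms by (simp add: sin_sq_def matrix_vector_mult_scaleR power_mult_distrib power2_eq_square)

text \<open>\<open>R (x k)\<close> is the squared distance from \<open>y k = s\<^sub>x x\<close> to \<open>\<alpha>\<close>, so \<open>y k\<close> converges to \<open>\<alpha>\<close> in seminorm, and the
  angle depends only on seminorm quantities. The vectors \<open>x k\<close> themselves may diverge.\<close>
lemma sin_sq_tendsto:
  assumes psd: "pos_semidefinite Q" and eq: "Q *v \<alpha> = c" and v: "v \<bullet> (Q *v v) > 0"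
    and pos: "c \<bullet> \<alpha> > 0"
    and x: "\<And>k. x k \<in> pos_cone c" and lim: "(\<lambda>k. R_map Q c \<alpha> (x k)) \<longlonglongrightarrow> 0"
  shows "(\<lambda>k. sin_sq Q (x k) v) \<longlonglongrightarrow> sin_sq Q \<alpha> v"
proof -
  define p where "p = v \<bullet> (Q *v v)"
  define y where "y = (\<lambda>k. opt_scale Q c (x k) *\<^sub>R x k)"
  define g where "g = (\<lambda>k. (y k - \<alpha>) \<bullet> (Q *v v))"
  have R: "R_map Q c \<alpha> (x k) = (y k - \<alpha>) \<bullet> (Q *v (y k - \<alpha>))" for k
    by (simp add: R_map_eq_D_map[OF psd eq] D_map_eq_residual[OF psd eq] y_def)
  have s: "opt_scale Q c (x k) \<noteq> 0" for k
    using x[of k] quadratic_pos_on_cone[OF psd eq x[of k]] by (simp add: opt_scale_def pos_cone_def)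
  have yy: "y k \<bullet> (Q *v y k) = c \<bullet> \<alpha> - R_map Q c \<alpha> (x k)" for k
    using x[of k] quadratic_pos_on_cone[OF psd eq x[of k]]
    by (simp add: R_map_closed_form[OF psd eq] y_def opt_scale_def matrix_vector_mult_scaleR
        power2_eq_square)
  have yv: "y k \<bullet> (Q *v v) = c \<bullet> v + g k" for k
    by (simp add: g_def inner_eq_Q_inner[OF psd eq] inner_diff_left)
  have S: "sin_sq Q (x k) v = 1 - (c \<bullet> v + g k)\<^sup>2 / ((c \<bullet> \<alpha> - R_map Q c \<alpha> (x k)) * p)" for k
  proof -
    have "sin_sq Q (x k) v = sin_sq Q (y k) v" unfolding y_def by (rule sin_sq_scaleR[OF s, symmetric])
    thus ?thesis unfolding sin_sq_def yy yv p_def .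
  qed
  have "(\<lambda>k. sqrt (R_map Q c \<alpha> (x k) * p)) \<longlonglongrightarrow> sqrt (0 * p)"
    by (intro tendsto_intros lim)
  moreover have "\<bar>g k\<bar> \<le> sqrt (R_map Q c \<alpha> (x k) * p)" for k
    using pos_semidefinite_Cauchy_Schwarz[OF psd, of "y k - \<alpha>" v] unfolding R g_def p_def
    by (intro real_le_rsqrt) simp
  ultimately have "g \<longlonglongrightarrow> 0"
    by (intro Lim_null_comparison[of g "\<lambda>k. sqrt (R_map Q c \<alpha> (x k) * p)"]) auto
  hence "(\<lambda>k. 1 - (c \<bullet> v + g k)\<^sup>2 / ((c \<bullet> \<alpha> - R_map Q c \<alpha> (x k)) * p))
      \<longlonglongrightarrow> 1 - (c \<bullet> v + 0)\<^sup>2 / ((c \<bullet> \<alpha> - 0) * p)"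
    using lim pos v by (intro tendsto_intros) (auto simp: p_def)
  thus ?thesis
    unfolding S using eq by (simp add: sin_sq_def p_def inner_eq_Q_inner[OF psd eq] inner_commute[of c \<alpha>])
qed

text \<open>Since \<open>1 - a\<close> could be negative, geometric decay is not used; instead the limit \<open>l\<close> of the decreasing
  sequence satisfies \<open>l \<le> (1 - a) l\<close>.\<close>
lemma contraction_sequence_tendsto_0:
  fixes u :: "nat \<Rightarrow> real"
  assumes "\<And>k. u k \<ge> 0" "\<And>k. u (Suc k) \<le> (1 - a) * u k" "a > 0"
  shows "u \<longlonglongrightarrow> 0"
proof -
  have "u (Suc k) \<le> u k" for k
  proof -
    have "0 \<le> a * u k" using assms(1,3) by simp
    thus ?thesis using assms(2)[of k] by (simp add: algebra_simps)
  qed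
  hence "decseq u" by (rule decseq_SucI)
  moreover have "Bseq u"
    using \<open>decseq u\<close> assms(1) by (metis decseq_bounded)
  ultimately obtain l where l: "u \<longlonglongrightarrow> l"
    using Bseq_monoseq_convergent decseq_imp_monoseq convergent_def by blast
  have "l \<le> (1 - a) * l"
    by (rule LIMSEQ_le[OF LIMSEQ_Suc[OF l] tendsto_mult_left[OF l]]) (use assms(2) in auto)
  moreover have "l \<ge> 0" by (rule LIMSEQ_le_const[OF l]) (use assms(1) in auto)
  ultimately have "l = 0" using assms(3) by (simp add: algebra_simps mult_le_0_iff)
  with l show ?thesis by simp
qed

text \<open>A negative \<open>q\<close> is possible a priori, but then the sequence vanishes from \<open>K\<close> on.\<close>
lemma contraction_sequence_geometric_bound:
  fixes u :: "nat \<Rightarrow> real"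
  assumes nonneg: "\<And>k. u k \<ge> 0" and step: "\<And>k. k \<ge> K \<Longrightarrow> u (Suc k) \<le> q * u k" and "k \<ge> K"
  shows "u k \<le> q ^ (k - K) * u K"
proof (cases "q \<ge> 0")
  case True
  show ?thesis using \<open>k \<ge> K\<close>
  proof (induction k rule: dec_induct)
    case (step n)
    have "u (Suc n) \<le> q * u n" using step.hyps assms(2) by simp
    also have "\<dots> \<le> q * (q ^ (n - K) * u K)" using step.IH True by (rule mult_left_mono)
    finally show ?case using step.hyps by (simp add: Suc_diff_le)
  qed simp
next
  case False
  have "u n = 0" if "n \<ge> K" for n
  proof -
    have "0 \<le> q * u n" using step[OF that] nonneg[of "Suc n"] by linarith
    thus ?thesis using False nonneg[of n] by (simp add: zero_le_mult_iff)
  qed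
  thus ?thesis using \<open>k \<ge> K\<close> by simp
qed

section \<open>The asymptotic constant\<close>

lemma a_infty_eq_MIN_inverse_sin_sq:
  fixes Q :: "real^'n^'n"
  assumes "pos_semidefinite Q" "Q *v \<alpha> = c"
  shows "a_infty Q c = (MIN i. inverse (ereal (sin_sq Q \<alpha> (axis i 1))))"
proof -
  have "sin_sq Q \<alpha> (axis i 1) = 1 - (c $ i)\<^sup>2 / (Q $ i $ i * pinv_norm_sq Q c)" for i
    using assms inner_eq_Q_inner[OF assms, of "axis i 1"] pinv_norm_sq_eq[of Q \<alpha> c]
    by (simp add: sin_sq_def quadratic_axis inner_axis pos_semidefinite_def mult.commute inner_commute)
  thus ?thesis by (simp add: a_infty_def)
qed

text \<open>The product form of the bound stays meaningful for an index with \<open>sin_sq = 0\<close>, whose inverse is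
  \<open>\<infinity>\<close>.\<close>
lemma a_infty_finiteE:
  fixes Q :: "real^'n^'n"
  assumes "pos_semidefinite Q" "Q *v \<alpha> = c" "a_infty Q c \<noteq> \<infinity>"
  obtains a where "a_infty Q c = ereal a" "a > 0" "\<And>i. a * sin_sq Q \<alpha> (axis i 1) \<le> 1"
proof -
  define \<sigma> where "\<sigma> = (\<lambda>i. sin_sq Q \<alpha> (axis i 1))"
  define f where "f = (\<lambda>i. inverse (ereal (\<sigma> i)))"
  have \<sigma>: "\<sigma> i \<ge> 0" for i by (simp add: \<sigma>_def sin_sq_bounds assms(1))
  have A: "a_infty Q c = Min (range f)"
    by (simp add: a_infty_eq_MIN_inverse_sin_sq[OF assms(1,2)] f_def \<sigma>_def)
  have "Min (range f) \<in> range f" by (intro Min_in) auto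
  then obtain i where i: "a_infty Q c = f i" unfolding A by fastforce
  have "\<sigma> i \<noteq> 0" using i assms(3) by (auto simp: f_def)
  hence "\<sigma> i > 0" using \<sigma>[of i] by simp
  hence a: "a_infty Q c = ereal (inverse (\<sigma> i))" using i by (simp add: f_def)
  have "inverse (\<sigma> i) * \<sigma> j \<le> 1" for j
  proof (cases "\<sigma> j = 0")
    case False
    hence "\<sigma> j > 0" using \<sigma>[of j] by simp
    have "a_infty Q c \<le> f j" unfolding A by (intro Min_le) auto
    hence "inverse (\<sigma> i) \<le> inverse (\<sigma> j)" unfolding a using \<open>\<sigma> j > 0\<close> by (simp add: f_def)
    thus ?thesis using \<open>\<sigma> j > 0\<close> \<open>\<sigma> i > 0\<close> by (simp add: field_simps)
  qed simp
  thus ?thesis using a \<open>\<sigma> i > 0\<close> that by (auto simp: \<sigma>_def)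
qed

lemma a_infty_infinite:
  fixes Q :: "real^'n^'n"
  assumes "pos_semidefinite Q" "Q *v \<alpha> = c" "a_infty Q c = \<infinity>"
  shows "sin_sq Q \<alpha> (axis i 1) = 0"
proof -
  have "a_infty Q c \<le> inverse (ereal (sin_sq Q \<alpha> (axis i 1)))"
    unfolding a_infty_eq_MIN_inverse_sin_sq[OF assms(1,2)] by (intro Min_le) auto
  thus ?thesis using assms(3) by (cases "sin_sq Q \<alpha> (axis i 1) = 0") auto
qed

lemma R_map_signed_direction_eq_sin_sq:
  assumes "pos_semidefinite Q" "Q *v \<alpha> = c" "v \<bullet> (Q *v v) > 0" "c \<bullet> \<alpha> \<noteq> 0"
  shows "R_map Q c \<alpha> (sgn (c \<bullet> v) *\<^sub>R v) = (c \<bullet> \<alpha>) * sin_sq Q \<alpha> v"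
  using assms(2-4) unfolding R_map_signed_direction[OF assms(1-3)] sin_sq_def
  by (simp add: inner_eq_Q_inner[OF assms(1,2), symmetric] inner_commute[of \<alpha> c] field_simps)

section \<open>The asymptotic rate\<close>

text \<open>The first two properties are upper bounds on \<open>R (x k)\<close> (\<open>pos_cone_iff_R_map_less\<close> for the first one),
  so they persist because \<open>R\<close> does not increase along the iterates.\<close>
lemma exact_coordinate_descent_invariant:
  fixes Q :: "real^'n^'n"
  assumes psd: "pos_semidefinite Q" and diag: "\<And>i. Q $ i $ i > 0" and eq: "Q *v \<alpha> = c"
    and cd: "exact_coordinate_descent (H_rule Q c \<alpha>) Q c \<alpha> x \<or>
         exact_coordinate_descent (BI_rule Q c \<alpha>) Q c \<alpha> x"
  shows "x k \<in> pos_cone c" and "R_map Q c \<alpha> (x k) \<le> R_map Q c \<alpha> (sgn (c $ j) *\<^sub>R axis j 1)"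
    and "\<exists>i. (i \<in> H_rule Q c \<alpha> (x k) \<or> i \<in> BI_rule Q c \<alpha> (x k)) \<and>
      x (Suc k) = x k + exact_step Q c (x k) i *\<^sub>R axis i 1"
proof -
  show step: "\<exists>i. (i \<in> H_rule Q c \<alpha> (x k) \<or> i \<in> BI_rule Q c \<alpha> (x k)) \<and>
      x (Suc k) = x k + exact_step Q c (x k) i *\<^sub>R axis i 1" for k
    using cd unfolding exact_coordinate_descent_def by metis
  have "x k \<in> pos_cone c \<and> (\<forall>j. R_map Q c \<alpha> (x k) \<le> R_map Q c \<alpha> (sgn (c $ j) *\<^sub>R axis j 1))" for k
  proof (induction k)
    case 0
    show ?case using cd by (auto simp: exact_coordinate_descent_def)
  next
    case (Suc k)
    obtain i where i: "i \<in> H_rule Q c \<alpha> (x k) \<or> i \<in> BI_rule Q c \<alpha> (x k)"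
      and x': "x (Suc k) = x k + exact_step Q c (x k) i *\<^sub>R axis i 1" using step by metis
    have "R_map Q c \<alpha> (x (Suc k)) \<le> R_map Q c \<alpha> (x k)"
      using exact_step_contraction[OF psd diag eq _ _ i, of 0] Suc by (simp add: x')
    thus ?case using Suc unfolding pos_cone_iff_R_map_less[OF psd eq] by (meson le_less_trans order_trans)
  qed
  thus "x k \<in> pos_cone c" "R_map Q c \<alpha> (x k) \<le> R_map Q c \<alpha> (sgn (c $ j) *\<^sub>R axis j 1)" by auto
qed

lemma exact_coordinate_descent_contraction:
  fixes Q :: "real^'n^'n"
  assumes psd: "pos_semidefinite Q" and diag: "\<And>i. Q $ i $ i > 0" and eq: "Q *v \<alpha> = c"
    and cd: "exact_coordinate_descent (H_rule Q c \<alpha>) Q c \<alpha> x \<or>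
         exact_coordinate_descent (BI_rule Q c \<alpha>) Q c \<alpha> x"
    and \<kappa>: "\<kappa> \<ge> 0" "\<And>j. \<kappa> * sin_sq Q (x k) (axis j 1) \<le> 1"
  shows "R_map Q c \<alpha> (x (Suc k)) \<le> (1 - iota Q * \<kappa>) * R_map Q c \<alpha> (x k)"
proof -
  note inv = exact_coordinate_descent_invariant[OF psd diag eq cd]
  obtain i where "i \<in> H_rule Q c \<alpha> (x k) \<or> i \<in> BI_rule Q c \<alpha> (x k)"
      and x': "x (Suc k) = x k + exact_step Q c (x k) i *\<^sub>R axis i 1" using inv(3) by metis
  from exact_step_contraction[OF psd diag eq inv(1,2) this(1) \<kappa>] show ?thesis by (simp add: x')
qed

theorem theorem4p3:
  fixes Q :: "real^'n^'n" and c \<alpha> :: "real^'n" and x :: "nat \<Rightarrow> real^'n" and \<epsilon> :: real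
  assumes "pos_semidefinite Q"
    and "\<And>i. Q $ i $ i > 0"
    and "c \<noteq> 0"
    and "Q *v \<alpha> = c"
    and "exact_coordinate_descent (H_rule Q c \<alpha>) Q c \<alpha> x \<or>
         exact_coordinate_descent (BI_rule Q c \<alpha>) Q c \<alpha> x"
    and "0 < \<epsilon>" and "\<epsilon> < 1"
  shows "\<exists>k\<^sub>\<epsilon>. \<forall>k\<ge>k\<^sub>\<epsilon>.
    (if a_infty Q c = \<infinity> then R_map Q c \<alpha> (x k) = 0
     else R_map Q c \<alpha> (x k) \<le>
       (1 - iota Q * real_of_ereal (a_infty_eps Q c \<epsilon>)) ^ (k - k\<^sub>\<epsilon>) * R_map Q c \<alpha> (x k\<^sub>\<epsilon>))"
proof -
  note psd = assms(1) and diag = assms(2) and eq = assms(4) and cd = assms(5)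
  note cone = exact_coordinate_descent_invariant(1)[OF psd diag eq cd]
    and init = exact_coordinate_descent_invariant(2)[OF psd diag eq cd]
    and contraction = exact_coordinate_descent_contraction[OF psd diag eq cd]
    and nonneg = R_map_nonneg[OF psd eq]
  have axis: "axis i 1 \<bullet> (Q *v axis i 1) > 0" for i using diag by (simp add: quadratic_axis)
  have pos: "c \<bullet> \<alpha> > 0"
    using nonneg[of "x 0"] cone[of 0] unfolding pos_cone_iff_R_map_less[OF psd eq] by linarith
  show ?thesis
  proof (cases "a_infty Q c = \<infinity>")
    case True
    \<comment> \<open>Each axis already contains a minimiser, so the initial iterate is optimal.\<close>
    have "R_map Q c \<alpha> (sgn (c $ i) *\<^sub>R axis i 1) = 0" for i
      using R_map_signed_direction_eq_sin_sq[OF psd eq axis[of i]] a_infty_infinite[OF psd eq True] pos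
      by (simp add: inner_axis)
    hence "R_map Q c \<alpha> (x k) = 0" for k using init[of k] nonneg[of "x k"] by (simp add: antisym)
    thus ?thesis using True by simp
  next
    case False
    then obtain a where a: "a_infty Q c = ereal a" "a > 0" "\<And>i. a * sin_sq Q \<alpha> (axis i 1) \<le> 1"
      using a_infty_finiteE[OF psd eq] by metis
    \<comment> \<open>The factor \<open>1 - \<epsilon>\<close> turns the limiting bound \<open>a * sin_sq Q \<alpha> (axis i 1) \<le> 1\<close> into a strict one.\<close>
    define \<kappa> where "\<kappa> = (1 - \<epsilon>) * a"
    have \<kappa>: "\<kappa> \<ge> 0" using a(2) assms(7) by (simp add: \<kappa>_def)
    have lim: "(\<lambda>k. R_map Q c \<alpha> (x k)) \<longlonglongrightarrow> 0"
      using contraction[of 1] sin_sq_bounds(2)[OF psd] iota_pos[OF psd diag]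
      by (intro contraction_sequence_tendsto_0[of _ "iota Q"] nonneg) auto
    have "\<forall>\<^sub>F k in sequentially. \<kappa> * sin_sq Q (x k) (axis i 1) < 1" for i
    proof (rule order_tendstoD(2))
      show "(\<lambda>k. \<kappa> * sin_sq Q (x k) (axis i 1)) \<longlonglongrightarrow> \<kappa> * sin_sq Q \<alpha> (axis i 1)"
        by (intro tendsto_mult_left sin_sq_tendsto[OF psd eq axis pos cone lim])
      have "\<kappa> * sin_sq Q \<alpha> (axis i 1) \<le> (1 - \<epsilon>) * 1"
        unfolding \<kappa>_def mult.assoc using a(3) assms(7) by (intro mult_left_mono) auto
      thus "\<kappa> * sin_sq Q \<alpha> (axis i 1) < 1" using assms(6) by simp
    qed
    hence "\<forall>\<^sub>F k in sequentially. \<forall>i. \<kappa> * sin_sq Q (x k) (axis i 1) < 1"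
      by (rule eventually_all_finite)
    then obtain K where K: "\<And>k i. k \<ge> K \<Longrightarrow> \<kappa> * sin_sq Q (x k) (axis i 1) < 1"
      by (auto simp: eventually_sequentially)
    have "R_map Q c \<alpha> (x k) \<le> (1 - iota Q * \<kappa>) ^ (k - K) * R_map Q c \<alpha> (x K)" if "k \<ge> K" for k
      using contraction[OF \<kappa>] K that nonneg
      by (intro contraction_sequence_geometric_bound[where u = "\<lambda>k. R_map Q c \<alpha> (x k)"])
        (auto intro: less_imp_le)
    moreover have "real_of_ereal (a_infty_eps Q c \<epsilon>) = \<kappa>" by (simp add: a_infty_eps_def a(1) \<kappa>_def)
    ultimately show ?thesis using False by auto
  qed
qed

end
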